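(* Let $a_0\in\mathbb{C}$ and $r_0>0$ be such that $\overline{D(a_0,r_0)}\subset\mathbb{D}$, and let $f$ be a function that is analytic and nonvanishing in a neighborhood of $\overline{D(a_0,r_0)}$. Then for every $\delta$ with $0<\delta<r_0$, $f$ can be uniformly approximated on $D(a_0,r_0-\delta)$ by a constant times a Blaschke product with zeros on the circle $\{z:|z-a_0|=r_0\}$; that is, for every $\varepsilon>0$ there exist a constant $c\in\mathbb{C}$ and a Blaschke product $B$, all of whose zeros lie on $\{z:|z-a_0|=r_0\}$, such that $|f(z)-cB(z)|<\varepsilon$ for all $z\in D(a_0,r_0-\delta)$.
   Context: $\mathbb{D}=\{z\in\mathbb{C}:|z|<1\}$, and $D(a,s)=\{z\in\mathbb{C}:|z-a|<s\}$ is the open Euclidean disc. A Blaschke product is a function on $\mathbb{D}$ of the form $B(z)=\lambda z^n\prod_{j}\frac{-\overline{a_j}}{|a_j|}\frac{z-a_j}{1-\overline{a_j}z}$, where $n$ is a nonnegative integer, $|\lambda|=1$, $0<|a_j|<1$, and the (finite or countably infinite) family $(a_j)$ satisfies $\sum_j(1-|a_j|)<\infty$. *)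

theory Defs
  imports "HOL-Complex_Analysis.Complex_Analysis"
begin

definition blaschke_factor :: "complex \<Rightarrow> complex \<Rightarrow> complex" where
  "blaschke_factor a z =
     - cnj a / of_real (cmod a) * ((z - a) / (1 - cnj a * z))"

(* The finite or countably infinite family of nonzero zeros (with repetitions) is indexed by an
   arbitrary set J of natural numbers; indices outside J contribute the factor 1. The Blaschke
   condition makes the product converge for |z| < 1. Values of B outside the
   unit disc are left unconstrained. *)
definition is_blaschke_product :: "(complex \<Rightarrow> complex) \<Rightarrow> bool" where
  "is_blaschke_product B \<longleftrightarrow>
     (\<exists>(n::nat) (l::complex) (J::nat set) (a::nat \<Rightarrow> complex).
        cmod l = 1 \<and>
        (\<forall>j\<in>J. 0 < cmod (a j) \<and> cmod (a j) < 1) \<and>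
        (\<lambda>j. 1 - cmod (a j)) summable_on J \<and>
        (\<forall>z\<in>ball 0 1.
           B z = l * z ^ n * (\<Prod>j. if j \<in> J then blaschke_factor (a j) z else 1)))"

end

theory Submission
  imports Defs "HOL-Computational_Algebra.Fundamental_Theorem_Algebra"
begin

text \<open>
  A Moebius automorphism of the unit disc carries the given circle to \<open>|z| = \<rho>\<close> and Blaschke products
  to Blaschke products, so the disc may be taken to be centred at the origin. There the reflection
  of \<open>z\<close> with \<open>|z| = \<rho>\<close> in the unit circle is \<open>z / \<rho>\<^sup>2\<close>, hence a polynomial \<open>P\<close> with all its roots on
  \<open>|z| = \<rho>\<close> makes \<open>P z / P (\<rho>\<^sup>2 z)\<close> a constant times a Blaschke product. If \<open>q\<close> is a polynomial
  without zeros on \<open>|z| \<le> \<rho>\<close>, the roots of \<open>q z + (z / \<rho>)\<^sup>N cnj (q (\<rho>\<^sup>2 / cnj z))\<close> lie on \<open>|z| = \<rho>\<close> by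
  the maximum modulus principle, and this polynomial tends to \<open>q\<close> locally uniformly on \<open>|z| < \<rho>\<close>.
  Consequently every \<open>Q z / Q (\<rho>\<^sup>2 z)\<close> with \<open>Q\<close> holomorphic and nonvanishing can be approximated,
  and up to a constant every nonvanishing holomorphic function is a limit of such quotients.
\<close>

subsection \<open>Polynomials with all roots on a circle\<close>

text \<open>The Taylor polynomials at 0 serve: a power series converges uniformly on closed discs
  strictly inside its disc of convergence.\<close>

lemma holomorphic_uniform_limit_polynomials:
  fixes Q :: "complex \<Rightarrow> complex"
  assumes "Q holomorphic_on ball 0 R" "0 < \<rho>" "\<rho> < R"
  obtains p where "uniform_limit (cball 0 \<rho>) (\<lambda>n. poly (p n)) Q sequentially"
proof -
  define a where "a n = (deriv ^^ n) Q 0 / fact n" for n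
  have sums: "(\<lambda>n. a n * z ^ n) sums Q z" if "cmod z < R" for z
    using holomorphic_power_series[OF assms(1), of z] that by (simp add: a_def)
  \<comment> \<open>Convergence at a single point of modulus strictly between \<open>\<rho>\<close>
    and \<open>R\<close> already pushes the radius of convergence above
    \<open>\<rho>\<close>.\<close>
  define w where "w = (\<rho> + R) / 2"
  have w: "\<rho> < w" "w < R"
    using assms by (auto simp: w_def)
  have "summable (\<lambda>n. a n * of_real w ^ n)"
    using sums[of "of_real w"] w assms by (auto simp: sums_iff)
  then have "conv_radius a \<ge> ereal (cmod (of_real w))"
    by (rule conv_radius_geI)
  then have "ereal \<rho> < conv_radius a"
    using w assms by (auto intro: less_le_trans[of _ "ereal w"])
  then have "uniform_limit (cball 0 \<rho>) (\<lambda>n z. \<Sum>i<n. a i * (z - 0) ^ i)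
      (\<lambda>z. \<Sum>i. a i * (z - 0) ^ i) sequentially"
    by (rule powser_uniform_limit)
  then have "uniform_limit (cball 0 \<rho>) (\<lambda>n. poly (\<Sum>i<n. monom (a i) i)) Q sequentially"
    by (rule uniform_limit_cong'[THEN iffD1, rotated -1])
      (use sums assms in \<open>auto simp: poly_sum poly_monom sums_iff\<close>)
  then show thesis
    by (rule that)
qed

text \<open>The added sum is \<open>(z / \<rho>)\<^sup>N cnj (q (\<rho>\<^sup>2 / cnj z))\<close> written out as a polynomial.\<close>
definition circle_completion :: "real \<Rightarrow> complex poly \<Rightarrow> nat \<Rightarrow> complex poly" where
  "circle_completion \<rho> q N =
     q + (\<Sum>k\<le>degree q. monom (cnj (coeff q k) * of_real (\<rho> ^ (2 * k) / \<rho> ^ N)) (N - k))"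

lemma poly_circle_completion:
  assumes "\<rho> > 0" "degree q \<le> N" "z \<noteq> 0"
  shows "poly (circle_completion \<rho> q N) z
    = poly q z + (z / of_real \<rho>) ^ N * cnj (poly q (of_real (\<rho>\<^sup>2) / cnj z))"
proof -
  have "cnj (coeff q k) * of_real (\<rho> ^ (2 * k) / \<rho> ^ N) * z ^ (N - k)
      = (z / of_real \<rho>) ^ N * (cnj (coeff q k) * (of_real (\<rho>\<^sup>2) / z) ^ k)" if "k \<le> degree q" for k
    using assms that by (simp add: power_diff power_divide field_simps flip: power_mult)
  then show ?thesis
    using assms by (simp add: circle_completion_def poly_sum poly_monom poly_altdef[of q] sum_distrib_left)
qed

text \<open>The two summands of the completion have equal modulus on the circle; since the second has a zero
  at the origin, the first dominates inside. The outside reduces to the inside by reflection in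
  the circle, under which the completion is invariant up to a nonvanishing factor.\<close>
lemma circle_completion_roots:
  assumes \<rho>: "\<rho> > 0" and N: "degree q < N"
    and nz: "\<And>z. cmod z \<le> \<rho> \<Longrightarrow> poly q z \<noteq> 0"
    and root: "poly (circle_completion \<rho> q N) z = 0"
  shows "cmod z = \<rho>"
proof -
  define P where "P = circle_completion \<rho> q N"
  \<comment> \<open>The added summand of the completion divided by \<open>z\<close>;
    \<open>k \<le> degree q < N\<close> makes \<open>N - Suc k\<close> a genuine
    subtraction.\<close>
  define g where "g = (\<lambda>z. \<Sum>k\<le>degree q.
    cnj (coeff q k) * of_real (\<rho> ^ (2 * k) / \<rho> ^ N) * z ^ (N - Suc k))"
  have P_eq: "poly P z = poly q z + z * g z" for z
  proof -
    have "z ^ (N - k) = z * z ^ (N - Suc k)" if "k \<le> degree q" for k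
      using N that by (metis Suc_diff_Suc le_less_trans power_Suc)
    then show ?thesis
      by (simp add: P_def circle_completion_def g_def poly_sum poly_monom sum_distrib_left mult_ac)
  qed
  have inside: "poly P z \<noteq> 0" if z: "cmod z < \<rho>" for z
  proof
    assume "poly P z = 0"
    have "cmod (g z / poly q z) \<le> 1 / \<rho>"
    proof (rule maximum_modulus_frontier[where f = "\<lambda>z. g z / poly q z" and S = "cball 0 \<rho>"])
      show "(\<lambda>z. g z / poly q z) holomorphic_on interior (cball 0 \<rho>)"
        using nz \<rho> by (force simp: g_def intro!: holomorphic_intros)
      show "continuous_on (closure (cball 0 \<rho>)) (\<lambda>z. g z / poly q z)"
        using nz \<rho> by (force simp: g_def intro!: continuous_intros)
      fix u :: complex
      assume "u \<in> frontier (cball 0 \<rho>)"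
      then have u: "cmod u = \<rho>"
        using \<rho> by simp
      then have "u \<noteq> 0"
        using \<rho> by auto
      \<comment> \<open>Reflection fixes the points of the circle, so there \<open>u * g u\<close>
        is a unimodular multiple of \<open>cnj (poly q u)\<close>.\<close>
      have "of_real (\<rho>\<^sup>2) / cnj u = u"
        using u \<open>u \<noteq> 0\<close> by (simp add: complex_norm_square[symmetric] divide_simps flip: of_real_power)
      then have "u * g u = (u / of_real \<rho>) ^ N * cnj (poly q u)"
        using poly_circle_completion[OF \<rho> less_imp_le[OF N] \<open>u \<noteq> 0\<close>] P_eq[of u] by (simp add: P_def)
      then have "\<rho> * cmod (g u) = cmod (poly q u)"
        using u \<rho> by (metis complex_mod_cnj divide_self_if less_irrefl mult_1 norm_divide
               norm_mult norm_of_real norm_power power_one abs_of_pos)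
      then show "cmod (g u / poly q u) \<le> 1 / \<rho>"
        using \<rho> nz[of u] u by (simp add: norm_divide field_simps)
    qed (use z in auto)
    then have "cmod (g z) * \<rho> \<le> cmod (poly q z)"
      using \<rho> nz[of z] z by (simp add: norm_divide field_simps)
    \<comment> \<open>At a root the two summands have equal modulus. Together with the previous
      bound and |z| < \<open>\<rho>\<close> this forces \<open>g z = 0\<close>, hence
      \<open>poly q z = 0\<close>, which is excluded.\<close>
    moreover have "cmod (poly q z) = cmod z * cmod (g z)"
      using \<open>poly P z = 0\<close> P_eq[of z] by (metis add_eq_0_iff norm_minus_cancel norm_mult)
    ultimately show False
      using z nz[of z] by (metis less_eq_real_def mult.commute mult_left_mono mult_less_cancel_right_disj
             norm_ge_zero not_less zero_less_norm_iff mult_zero_right)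
  qed
  have "\<not> \<rho> < cmod z"
  proof
    assume z: "\<rho> < cmod z"
    then have "z \<noteq> 0"
      using \<rho> by auto
    \<comment> \<open>The mirror image of \<open>z\<close> in the circle, which lies inside. The
      computation below shows that \<open>poly P u\<close> is \<open>(u / \<rho>) ^ N\<close> times
      \<open>cnj (poly P z)\<close>, so it would vanish as well.\<close>
    define u where "u = of_real (\<rho>\<^sup>2) / cnj z"
    have u: "u \<noteq> 0" "of_real (\<rho>\<^sup>2) / cnj u = z"
      using \<open>z \<noteq> 0\<close> \<rho> by (auto simp: u_def)
    have "cmod u = \<rho> * \<rho> / cmod z"
      using \<rho> by (simp add: u_def norm_divide power2_eq_square norm_mult)
    also have "\<dots> < \<rho>"
      using \<rho> z by (simp add: divide_simps)
    finally have "poly P u \<noteq> 0"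
      by (rule inside)
    have "(u / of_real \<rho>) * cnj (z / of_real \<rho>) = 1"
      using \<rho> \<open>z \<noteq> 0\<close> by (simp add: u_def power2_eq_square)
    then have one: "(u / of_real \<rho>) ^ N * cnj (z / of_real \<rho>) ^ N = 1"
      by (metis power_mult_distrib power_one)
    have "poly P u = poly q u + (u / of_real \<rho>) ^ N * cnj (poly q z)"
      using poly_circle_completion[OF \<rho> less_imp_le[OF N] u(1)] u(2) by (simp add: P_def)
    also have "\<dots> = (u / of_real \<rho>) ^ N * cnj (z / of_real \<rho>) ^ N * poly q u
        + (u / of_real \<rho>) ^ N * cnj (poly q z)"
      unfolding one by simp
    also have "\<dots> = (u / of_real \<rho>) ^ N * cnj (poly P z)"
      using poly_circle_completion[OF \<rho> less_imp_le[OF N] \<open>z \<noteq> 0\<close>]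
      by (simp add: P_def u_def algebra_simps)
    finally show False
      using root \<open>poly P u \<noteq> 0\<close> by (simp add: P_def)
  qed
  with inside[of z] root show ?thesis
    unfolding P_def by force
qed

text \<open>The number of added terms is fixed by the degree of \<open>q\<close>, and on |z| \<le> s
  each of them is \<open>O((s / \<rho>) ^ N)\<close>.\<close>

lemma uniform_limit_circle_completion:
  assumes s: "0 < s" "s < \<rho>"
  shows "uniform_limit (cball 0 s) (\<lambda>N. poly (circle_completion \<rho> q N)) (poly q) sequentially"
proof -
  \<comment> \<open>What is left of the bound after extracting \<open>(s / \<rho>) ^ N\<close> from
    \<open>\<rho> ^ (2 * k) / \<rho> ^ N * s ^ (N - k)\<close>; it does not depend on
    \<open>N\<close>.\<close>
  define C where "C = (\<Sum>k\<le>degree q. cmod (coeff q k) * \<rho> ^ (2 * k) / s ^ k)"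
  have "(\<lambda>N. (s / \<rho>) ^ N * C) \<longlonglongrightarrow> 0"
    using s by (intro tendsto_mult_left_zero LIMSEQ_realpow_zero) auto
  then have lim: "eventually (\<lambda>N. (s / \<rho>) ^ N * C < e) sequentially" if "e > 0" for e
    using that by (auto dest: order_tendstoD)
  have bound: "cmod (poly (circle_completion \<rho> q N) z - poly q z) \<le> (s / \<rho>) ^ N * C"
    if "degree q \<le> N" "cmod z \<le> s" for N z
  proof -
    have "poly (circle_completion \<rho> q N) z - poly q z
        = (\<Sum>k\<le>degree q. cnj (coeff q k) * of_real (\<rho> ^ (2 * k) / \<rho> ^ N) * z ^ (N - k))"
      by (simp add: circle_completion_def poly_sum poly_monom)
    also have "cmod \<dots> \<le> (\<Sum>k\<le>degree q. cmod (coeff q k) * (\<rho> ^ (2 * k) / \<rho> ^ N) * s ^ (N - k))"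
      using that s
      by (intro order_trans[OF norm_sum] sum_mono)
        (auto simp: norm_mult norm_power norm_divide intro!: mult_left_mono divide_right_mono power_mono)
    also have "\<dots> = (s / \<rho>) ^ N * C"
      unfolding C_def sum_distrib_left using that s
      by (intro sum.cong) (auto simp: power_diff power_divide)
    finally show ?thesis .
  qed
  show ?thesis
  proof (rule uniform_limitI)
    fix e :: real
    assume "e > 0"
    from lim[OF this] eventually_ge_at_top[of "degree q"]
    show "\<forall>\<^sub>F N in sequentially. \<forall>z\<in>cball 0 s. dist (poly (circle_completion \<rho> q N) z) (poly q z) < e"
      by eventually_elim (auto simp: dist_norm intro: le_less_trans[OF bound])
  qed
qed

text \<open>Since \<open>\<rho>\<^sup>2 = a * cnj a\<close> for every root \<open>a\<close>, each
  linear factor of the denominator is \<open>- a * (1 - cnj a * z)\<close>. With x / 0 = 0 both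
  sides vanish wherever some \<open>1 - cnj a * z\<close> does, so the identity is valid at every
  \<open>z\<close>.\<close>

lemma blaschke_quotient_eq_poly_quotient:
  fixes p :: "complex poly"
  assumes "p \<noteq> 0" "\<rho> > 0" "\<And>z. poly p z = 0 \<Longrightarrow> cmod z = \<rho>"
  obtains k where "\<And>z. poly p z / poly p (of_real (\<rho>\<^sup>2) * z)
    = k * (\<Prod>a\<in>#proots p. (z - a) / (1 - cnj a * z))"
proof
  define A where "A = proots p"
  have A: "cmod a = \<rho>" "a \<noteq> 0" if "a \<in># A" for a
    using that assms(1,2) assms(3)[of a] by (auto simp: A_def)
  have p: "poly p z = lead_coeff p * (\<Prod>a\<in>#A. z - a)" for z
  proof -
    have "poly p z = poly (smult (lead_coeff p) (\<Prod>a\<in>#A. [:-a, 1:])) z"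
      by (simp add: A_def complex_poly_decompose_multiset)
    then show ?thesis
      by (simp add: poly_prod_mset)
  qed
  have "of_real (\<rho>\<^sup>2) * z - a = - a * (1 - cnj a * z)" if "a \<in># A" for a z
    using A[OF that] complex_norm_square[of a] by (simp add: algebra_simps)
  then have "(\<Prod>a\<in>#A. of_real (\<rho>\<^sup>2) * z - a) = (\<Prod>a\<in>#A. - a) * (\<Prod>a\<in>#A. 1 - cnj a * z)" for z
    by (simp flip: prod_mset.distrib cong: image_mset_cong)
  moreover have "(\<Prod>a\<in>#A. (z - a) / (1 - cnj a * z)) = (\<Prod>a\<in>#A. z - a) / (\<Prod>a\<in>#A. 1 - cnj a * z)" for z
    by (induction A) auto
  ultimately show "poly p z / poly p (of_real (\<rho>\<^sup>2) * z)
      = inverse (\<Prod>a\<in>#A. - a) * (\<Prod>a\<in>#proots p. (z - a) / (1 - cnj a * z))" for z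
    using assms(1) by (simp add: p A_def[symmetric] field_simps)
qed

text \<open>Compactness supplies what uniform convergence of quotients requires: \<open>f\<close> is
  bounded, and |g| attains a positive minimum.\<close>

lemma uniform_limit_divide_compact:
  fixes f g :: "complex \<Rightarrow> complex"
  assumes "uniform_limit S fn f sequentially" "uniform_limit S gn g sequentially"
    and "compact S" "continuous_on S f" "continuous_on S g" "\<And>z. z \<in> S \<Longrightarrow> g z \<noteq> 0"
  shows "uniform_limit S (\<lambda>n z. fn n z / gn n z) (\<lambda>z. f z / g z) sequentially"
proof (cases "S = {}")
  case False
  obtain x where x: "x \<in> S" "\<And>z. z \<in> S \<Longrightarrow> cmod (g x) \<le> cmod (g z)"
    using continuous_attains_inf[of S "\<lambda>z. cmod (g z)"] assms False
    by (auto intro: continuous_on_norm)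
  show ?thesis
    using assms x by (intro uniform_lim_divide[where b = "cmod (g x)"])
      (auto intro!: compact_imp_bounded compact_continuous_image)
qed auto


subsection \<open>Approximation on discs centred at the origin\<close>

text \<open>A multiset records zeros with multiplicity; the unimodular normalisations of the
  Blaschke factors are absorbed into the arbitrary constant \<open>c\<close>.\<close>

definition circle_blaschke_quotients :: "real \<Rightarrow> (complex \<Rightarrow> complex) set" where
  "circle_blaschke_quotients \<rho> =
     {\<lambda>z. c * (\<Prod>a\<in>#A. (z - a) / (1 - cnj a * z)) | c A. \<forall>a\<in>#A. cmod a = \<rho>}"

definition approximable_on :: "complex set \<Rightarrow> (complex \<Rightarrow> complex) set \<Rightarrow> (complex \<Rightarrow> complex) \<Rightarrow> bool" where
  "approximable_on S X G \<longleftrightarrow> (\<forall>\<epsilon>>0. \<exists>g\<in>X. \<forall>z\<in>S. cmod (G z - g z) < \<epsilon>)"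

lemma approximable_on_member: "g \<in> X \<Longrightarrow> approximable_on S X g"
  unfolding approximable_on_def by force

text \<open>Closure under uniform limits lets each later reduction, from holomorphic functions to
  quotients and from these to polynomials, be stated as a limit without handling errors
  again.\<close>

lemma approximable_on_uniform_limit:
  assumes "uniform_limit S Gn G sequentially" "\<forall>\<^sub>F n in sequentially. approximable_on S X (Gn n)"
  shows "approximable_on S X G"
  unfolding approximable_on_def
proof (intro allI impI)
  fix \<epsilon> :: real
  assume "\<epsilon> > 0"
  then have "\<forall>\<^sub>F n in sequentially. \<forall>z\<in>S. dist (Gn n z) (G z) < \<epsilon> / 2"
    by (intro uniform_limitD[OF assms(1)]) simp
  with assms(2) have "\<forall>\<^sub>F n in sequentially. approximable_on S X (Gn n) \<and> (\<forall>z\<in>S. dist (Gn n z) (G z) < \<epsilon> / 2)"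
    by eventually_elim auto
  then obtain n where n: "approximable_on S X (Gn n)" "\<And>z. z \<in> S \<Longrightarrow> cmod (Gn n z - G z) < \<epsilon> / 2"
    by (auto simp: dist_norm dest: eventually_happens)
  from n(1) \<open>\<epsilon> > 0\<close> obtain g where g: "g \<in> X" "\<And>z. z \<in> S \<Longrightarrow> cmod (Gn n z - g z) < \<epsilon> / 2"
    unfolding approximable_on_def by (meson half_gt_zero)
  have "cmod (G z - g z) < \<epsilon>" if "z \<in> S" for z
    using n(2)[OF that] g(2)[OF that] norm_triangle_ineq[of "G z - Gn n z" "Gn n z - g z"]
    by (simp add: norm_minus_commute)
  with g(1) show "\<exists>g\<in>X. \<forall>z\<in>S. cmod (G z - g z) < \<epsilon>"
    by blast
qed

context
  fixes \<rho> s :: real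
  assumes \<rho>: "0 < \<rho>" "\<rho> < 1" and s: "0 < s" "s < \<rho>"
begin

lemma scale_mem_cball: "z \<in> cball 0 r \<Longrightarrow> of_real (\<rho>\<^sup>2) * z \<in> cball (0::complex) r"
proof -
  assume "z \<in> cball 0 r"
  moreover have "\<rho>\<^sup>2 * cmod z \<le> 1 * cmod z"
    using \<rho> by (intro mult_right_mono) (auto simp: power_le_one)
  ultimately show ?thesis
    by (simp add: norm_mult norm_power)
qed

text \<open>Replacing \<open>q\<close> by its completion puts the quotient into the class once
  \<open>N > degree q\<close>. The quotients converge because \<open>\<rho>\<^sup>2 * z\<close>
  stays in the disc where the completions converge and \<open>q\<close> has no zero.\<close>

lemma approximable_polynomial_quotient:
  assumes nz: "\<And>z. cmod z \<le> \<rho> \<Longrightarrow> poly q z \<noteq> 0"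
  shows "approximable_on (cball 0 s) (circle_blaschke_quotients \<rho>)
    (\<lambda>z. poly q z / poly q (of_real (\<rho>\<^sup>2) * z))"
proof (rule approximable_on_uniform_limit)
  define P where "P = circle_completion \<rho> q"
  have lim: "uniform_limit (cball 0 s) (\<lambda>N. poly (P N)) (poly q) sequentially"
    unfolding P_def using s by (rule uniform_limit_circle_completion)
  show "uniform_limit (cball 0 s) (\<lambda>N z. poly (P N) z / poly (P N) (of_real (\<rho>\<^sup>2) * z))
      (\<lambda>z. poly q z / poly q (of_real (\<rho>\<^sup>2) * z)) sequentially"
  proof (rule uniform_limit_divide_compact)
    show "uniform_limit (cball 0 s) (\<lambda>N z. poly (P N) (of_real (\<rho>\<^sup>2) * z))
        (\<lambda>z. poly q (of_real (\<rho>\<^sup>2) * z)) sequentially"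
      using lim by (rule uniform_limit_compose') (use scale_mem_cball in blast)
    show "poly q (of_real (\<rho>\<^sup>2) * z) \<noteq> 0" if "z \<in> cball 0 s" for z
      using scale_mem_cball[OF that] s by (intro nz) auto
  qed (use lim in \<open>auto intro!: continuous_intros\<close>)
  have "(\<lambda>z. poly (P N) z / poly (P N) (of_real (\<rho>\<^sup>2) * z)) \<in> circle_blaschke_quotients \<rho>"
    if "degree q < N" for N
  proof -
    have roots: "cmod z = \<rho>" if "poly (P N) z = 0" for z
      using circle_completion_roots[OF \<rho>(1) \<open>degree q < N\<close> nz, of z] that by (simp add: P_def)
    then have "P N \<noteq> 0"
      using \<rho> by force
    then obtain k where "\<And>z. poly (P N) z / poly (P N) (of_real (\<rho>\<^sup>2) * z)
        = k * (\<Prod>a\<in>#proots (P N). (z - a) / (1 - cnj a * z))"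
      using blaschke_quotient_eq_poly_quotient[OF _ \<rho>(1) roots] by blast
    with roots \<open>P N \<noteq> 0\<close> show ?thesis
      by (auto simp: circle_blaschke_quotients_def intro!: exI[of _ k] exI[of _ "proots (P N)"])
  qed
  then show "\<forall>\<^sub>F N in sequentially. approximable_on (cball 0 s) (circle_blaschke_quotients \<rho>)
      (\<lambda>z. poly (P N) z / poly (P N) (of_real (\<rho>\<^sup>2) * z))"
    by (intro eventually_mono[OF eventually_gt_at_top[of "degree q"]] approximable_on_member)
qed

lemma approximable_holomorphic_quotient:
  assumes hol: "Q holomorphic_on ball 0 R" and "\<rho> < R" and nz: "\<And>z. cmod z < R \<Longrightarrow> Q z \<noteq> 0"
  shows "approximable_on (cball 0 s) (circle_blaschke_quotients \<rho>) (\<lambda>z. Q z / Q (of_real (\<rho>\<^sup>2) * z))"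
proof -
  obtain p where p: "uniform_limit (cball 0 \<rho>) (\<lambda>n. poly (p n)) Q sequentially"
    using holomorphic_uniform_limit_polynomials[OF hol \<rho>(1) \<open>\<rho> < R\<close>] .
  have cont: "continuous_on (cball 0 \<rho>) Q"
    by (rule holomorphic_on_imp_continuous_on[OF holomorphic_on_subset[OF hol]]) (use \<open>\<rho> < R\<close> in auto)
  show ?thesis
  proof (rule approximable_on_uniform_limit)
    show "uniform_limit (cball 0 s) (\<lambda>n z. poly (p n) z / poly (p n) (of_real (\<rho>\<^sup>2) * z))
        (\<lambda>z. Q z / Q (of_real (\<rho>\<^sup>2) * z)) sequentially"
    proof (rule uniform_limit_divide_compact)
      have sub: "cball 0 s \<subseteq> cball (0::complex) \<rho>"
        using s by auto
      show "uniform_limit (cball 0 s) (\<lambda>n. poly (p n)) Q sequentially" "continuous_on (cball 0 s) Q"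
        using p cont sub by (auto intro: uniform_limit_on_subset continuous_on_subset)
      show "uniform_limit (cball 0 s) (\<lambda>n z. poly (p n) (of_real (\<rho>\<^sup>2) * z))
          (\<lambda>z. Q (of_real (\<rho>\<^sup>2) * z)) sequentially"
        using p by (rule uniform_limit_compose') (use scale_mem_cball sub in blast)
      show "continuous_on (cball 0 s) (\<lambda>z. Q (of_real (\<rho>\<^sup>2) * z))"
        using scale_mem_cball sub
        by (intro continuous_on_compose2[OF cont]) (auto intro!: continuous_intros simp del: mem_cball)
      show "Q (of_real (\<rho>\<^sup>2) * z) \<noteq> 0" if "z \<in> cball 0 s" for z
        using scale_mem_cball[OF that] s \<open>\<rho> < R\<close> by (intro nz) auto
    qed auto
    \<comment> \<open>The minimum of |Q| is the margin that keeps the polynomials zero-free. It is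
      taken over radius \<open>\<rho>\<close>, not \<open>s\<close>, because the polynomial case
      asks for no zeros on the larger disc.\<close>
    obtain x where x: "x \<in> cball 0 \<rho>" "\<And>z. z \<in> cball 0 \<rho> \<Longrightarrow> cmod (Q x) \<le> cmod (Q z)"
      using continuous_attains_inf[of "cball 0 \<rho>" "\<lambda>z. cmod (Q z)"] cont \<rho>
      by (force intro: continuous_on_norm)
    have "0 < cmod (Q x)"
      using nz[of x] x \<open>\<rho> < R\<close> by auto
    from uniform_limitD[OF p this]
    show "\<forall>\<^sub>F n in sequentially. approximable_on (cball 0 s) (circle_blaschke_quotients \<rho>)
        (\<lambda>z. poly (p n) z / poly (p n) (of_real (\<rho>\<^sup>2) * z))"
    proof (rule eventually_mono)
      fix n
      assume n: "\<forall>z\<in>cball 0 \<rho>. dist (poly (p n) z) (Q z) < cmod (Q x)"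
      show "approximable_on (cball 0 s) (circle_blaschke_quotients \<rho>)
        (\<lambda>z. poly (p n) z / poly (p n) (of_real (\<rho>\<^sup>2) * z))"
      proof (rule approximable_polynomial_quotient)
        fix z
        assume "cmod z \<le> \<rho>"
        then show "poly (p n) z \<noteq> 0"
          using n x(2)[of z] by (force simp: dist_norm)
      qed
    qed
  qed
qed

text \<open>The telescoping product \<open>Q z = (\<Prod>k<n. F (\<rho>\<^bsup>2k\<^esup> z))\<close> satisfies
  \<open>Q z / Q (\<rho>\<^sup>2 z) = F z / F (\<rho>\<^bsup>2n\<^esup> z)\<close>, which tends to \<open>F z / F 0\<close>.\<close>
lemma approximable_holomorphic:
  assumes hol: "F holomorphic_on ball 0 R" and "\<rho> < R" and nz: "\<And>z. cmod z < R \<Longrightarrow> F z \<noteq> 0"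
  shows "approximable_on (cball 0 s) (circle_blaschke_quotients \<rho>) (\<lambda>z. F z / F 0)"
proof (rule approximable_on_uniform_limit)
  define x where "x n = complex_of_real (\<rho>\<^sup>2) ^ n" for n
  have x: "cmod (x n * z) \<le> cmod z" for n z
    using \<rho> by (simp add: x_def norm_mult norm_power mult_left_le_one_le power_le_one)
  have cont: "continuous_on (cball 0 s) F"
    by (rule holomorphic_on_imp_continuous_on[OF holomorphic_on_subset[OF hol]]) (use \<open>\<rho> < R\<close> s in auto)
  have "isCont F 0"
    using hol \<rho> \<open>\<rho> < R\<close> by (auto simp: continuous_on_eq_continuous_at dest!: holomorphic_on_imp_continuous_on)
  have "uniform_limit (cball 0 s) (\<lambda>n z. F (x n * z)) (\<lambda>_. F 0) sequentially"
  proof (rule uniform_limitI)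
    fix e :: real
    assume "e > 0"
    then obtain d where d: "d > 0" "\<And>z. cmod z < d \<Longrightarrow> dist (F z) (F 0) < e"
      using \<open>isCont F 0\<close> unfolding continuous_at_eps_delta by (metis dist_0_norm dist_commute)
    have "(\<lambda>n. (\<rho>\<^sup>2) ^ n * s) \<longlonglongrightarrow> 0"
      using \<rho> by (intro tendsto_mult_left_zero LIMSEQ_realpow_zero) (auto simp: abs_square_less_1)
    then have "\<forall>\<^sub>F n in sequentially. (\<rho>\<^sup>2) ^ n * s < d"
      using d by (auto dest: order_tendstoD)
    then show "\<forall>\<^sub>F n in sequentially. \<forall>z\<in>cball 0 s. dist (F (x n * z)) (F 0) < e"
    proof eventually_elim
      case (elim n)
      show ?case
      proof
        fix z :: complex
        assume "z \<in> cball 0 s"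
        then have "cmod (x n * z) \<le> (\<rho>\<^sup>2) ^ n * s"
          by (simp add: x_def norm_mult norm_power mult_left_mono)
        with elim show "dist (F (x n * z)) (F 0) < e"
          by (intro d) simp
      qed
    qed
  qed
  then show "uniform_limit (cball 0 s) (\<lambda>n z. F z / F (x n * z)) (\<lambda>z. F z / F 0) sequentially"
    using cont nz[of 0] \<rho> \<open>\<rho> < R\<close> by (intro uniform_limit_divide_compact uniform_limit_const) auto
  show "\<forall>\<^sub>F n in sequentially. approximable_on (cball 0 s) (circle_blaschke_quotients \<rho>) (\<lambda>z. F z / F (x n * z))"
  proof (intro always_eventually allI)
    fix n
    define Q where "Q z = (\<Prod>k<n. F (x k * z))" for z
    have Q_nz: "Q z \<noteq> 0" if "cmod z < R" for z
      using nz[OF le_less_trans[OF x that]] by (simp add: Q_def)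
    have "(\<lambda>z. F (x k * z)) holomorphic_on ball 0 R" for k
    proof (rule holomorphic_on_compose_gen[OF _ hol, unfolded o_def])
      show "(*) (x k) ` ball 0 R \<subseteq> ball 0 R"
        using le_less_trans[OF x] by auto
    qed (intro holomorphic_intros)
    then have "Q holomorphic_on ball 0 R"
      unfolding Q_def by (intro holomorphic_intros)
    then have "approximable_on (cball 0 s) (circle_blaschke_quotients \<rho>) (\<lambda>z. Q z / Q (of_real (\<rho>\<^sup>2) * z))"
      using \<open>\<rho> < R\<close> Q_nz by (rule approximable_holomorphic_quotient)
    moreover have "Q z / Q (of_real (\<rho>\<^sup>2) * z) = F z / F (x n * z)" if "z \<in> cball 0 s" for z
    proof -
      have z: "cmod z < R"
        using that s \<open>\<rho> < R\<close> by simp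
      have shift: "F (x k * (of_real (\<rho>\<^sup>2) * z)) = F (x (Suc k) * z)" for k
        by (simp add: x_def mult_ac)
      \<comment> \<open>Scaling shifts the indices by one, so the product over
        \<open>k < Suc n\<close> can be read by splitting off its first or its last factor.\<close>
      have "F z * Q (of_real (\<rho>\<^sup>2) * z) = (\<Prod>k<Suc n. F (x k * z))"
        unfolding prod.lessThan_Suc_shift Q_def shift by (simp add: x_def)
      also have "\<dots> = Q z * F (x n * z)"
        by (simp add: Q_def)
      finally have "F z * Q (of_real (\<rho>\<^sup>2) * z) = Q z * F (x n * z)" .
      moreover have "Q (of_real (\<rho>\<^sup>2) * z) \<noteq> 0" "F (x n * z) \<noteq> 0"
        using x[of 1 z] x[of n z] z by (auto intro!: Q_nz nz simp: x_def)
      ultimately show ?thesis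
        by (simp add: divide_simps)
    qed
    ultimately show "approximable_on (cball 0 s) (circle_blaschke_quotients \<rho>) (\<lambda>z. F z / F (x n * z))"
      unfolding approximable_on_def by (metis (no_types, lifting))
  qed
qed

end

subsection \<open>Moebius transformations and Blaschke products\<close>

text \<open>By induction on the multiset, a zero at the origin raises \<open>n\<close>, and any
  other factor is a unimodular multiple of \<open>blaschke_factor\<close>. The nonzero zeros are
  collected in a list, whose positions become the index set \<open>J\<close>.\<close>

lemma is_blaschke_product_finite:
  fixes M :: "complex multiset"
  assumes "\<forall>b\<in>#M. cmod b < 1"
  shows "is_blaschke_product (\<lambda>z. \<Prod>b\<in>#M. (z - b) / (1 - cnj b * z))"
proof -
  have "\<exists>n l ys. cmod l = 1 \<and> (\<forall>y\<in>set ys. 0 < cmod y \<and> cmod y < 1) \<and>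
      (\<forall>z. (\<Prod>b\<in>#M. (z - b) / (1 - cnj b * z)) = l * z ^ n * (\<Prod>y\<leftarrow>ys. blaschke_factor y z))"
    using assms
  proof (induction M)
    case empty
    show ?case
      by (intro exI[of _ 0] exI[of _ 1] exI[of _ "[]"]) simp
  next
    case (add b M)
    then obtain n l ys where IH: "cmod l = 1" "\<forall>y\<in>set ys. 0 < cmod y \<and> cmod y < 1"
      "\<And>z. (\<Prod>b\<in>#M. (z - b) / (1 - cnj b * z)) = l * z ^ n * (\<Prod>y\<leftarrow>ys. blaschke_factor y z)"
      by auto
    show ?case
    proof (cases "b = 0")
      case True
      with IH show ?thesis
        by (intro exI[of _ "Suc n"] exI[of _ l] exI[of _ ys]) (auto simp: mult_ac)
    next
      case False
      \<comment> \<open>The reciprocal of the normalising constant \<open>- cnj b / |b|\<close> in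
        \<open>blaschke_factor\<close>.\<close>
      define k where "k = - of_real (cmod b) / cnj b"
      have "cmod k = 1"
        using False by (simp add: k_def norm_divide)
      moreover have "(z - b) / (1 - cnj b * z) = k * blaschke_factor b z" for z
        using False by (simp add: k_def blaschke_factor_def)
      ultimately show ?thesis
        using IH False add.prems
        by (intro exI[of _ n] exI[of _ "k * l"] exI[of _ "b # ys"]) (auto simp: mult_ac norm_mult)
    qed
  qed
  then obtain n l ys where l: "cmod l = 1" and ys: "\<forall>y\<in>set ys. 0 < cmod y \<and> cmod y < 1"
    and eq: "\<And>z. (\<Prod>b\<in>#M. (z - b) / (1 - cnj b * z)) = l * z ^ n * (\<Prod>y\<leftarrow>ys. blaschke_factor y z)"
    by blast
  have prodinf: "(\<Prod>j. if j \<in> {..<length ys} then blaschke_factor (ys ! j) z else 1)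
      = (\<Prod>y\<leftarrow>ys. blaschke_factor y z)" for z
    by (subst prodinf_finite[of "{..<length ys}"])
      (auto simp: prod.list_conv_set_nth atLeast0LessThan intro!: prod.cong)
  show ?thesis
    unfolding is_blaschke_product_def
    by (intro exI[of _ n] exI[of _ l] exI[of _ "{..<length ys}"] exI[of _ "\<lambda>j. ys ! j"])
      (use l ys in \<open>auto simp: eq prodinf[simplified]\<close>)
qed

lemma one_minus_cnj_mult_nonzero:
  fixes a z :: complex
  assumes "cmod a < 1" "cmod z < 1"
  shows "1 - cnj a * z \<noteq> 0"
proof
  assume "1 - cnj a * z = 0"
  then have "cmod a * cmod z = 1"
    by (metis complex_mod_cnj eq_iff_diff_eq_0 norm_mult norm_one)
  moreover have "cmod a * cmod z < 1"
    using assms by (metis mult_strict_mono' norm_ge_zero mult_1)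
  ultimately show False by simp
qed

text \<open>Invariance of the pseudohyperbolic quotient: numerator and denominator both acquire the
  factors \<open>m\<close> and \<open>1 / p\<close>, which cancel. The remaining constant
  \<open>q' / q\<close> is unimodular, as \<open>q' = cnj q\<close>.\<close>

lemma blaschke_quotient_Moebius:
  fixes w b z :: complex
  assumes "cmod w < 1" "cmod b < 1" "cmod z < 1"
  defines "\<phi> \<equiv> Moebius_function 0 w"
  shows "(\<phi> z - \<phi> b) / (1 - cnj (\<phi> b) * \<phi> z)
    = (1 - w * cnj b) / (1 - cnj w * b) * ((z - b) / (1 - cnj b * z))"
proof -
  define p where "p = 1 - cnj w * z"
  define q where "q = 1 - cnj w * b"
  define q' where "q' = 1 - w * cnj b"
  define m where "m = 1 - w * cnj w"
  have nz: "p \<noteq> 0" "q \<noteq> 0" "1 - cnj b * z \<noteq> 0" "m \<noteq> 0"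
    using one_minus_cnj_mult_nonzero[of w z] one_minus_cnj_mult_nonzero[of w b]
      one_minus_cnj_mult_nonzero[of b z] one_minus_cnj_mult_nonzero[of w w] assms
    by (auto simp: p_def q_def m_def mult.commute)
  have q': "q' = cnj q"
    by (simp add: q_def q'_def)
  then have "q' \<noteq> 0"
    using nz by simp
  have "\<phi> z - \<phi> b = (z - w) / p - (b - w) / q"
    by (simp add: \<phi>_def Moebius_function_simple p_def q_def)
  also have "\<dots> = ((z - w) * q - (b - w) * p) / (p * q)"
    using nz by (simp add: divide_simps)
  also have "(z - w) * q - (b - w) * p = m * (z - b)"
    by (simp add: p_def q_def m_def algebra_simps)
  finally have num: "\<phi> z - \<phi> b = m * (z - b) / (p * q)" .
  have "cnj (\<phi> b) = (cnj b - cnj w) / q'"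
    by (simp add: \<phi>_def Moebius_function_simple q'_def)
  moreover have "\<phi> z = (z - w) / p"
    by (simp add: \<phi>_def Moebius_function_simple p_def)
  ultimately have "1 - cnj (\<phi> b) * \<phi> z = 1 - (cnj b - cnj w) * (z - w) / (q' * p)"
    by simp
  also have "\<dots> = (q' * p - (cnj b - cnj w) * (z - w)) / (q' * p)"
    using nz \<open>q' \<noteq> 0\<close> by (simp add: diff_divide_distrib)
  also have "q' * p - (cnj b - cnj w) * (z - w) = m * (1 - cnj b * z)"
    by (simp add: p_def q'_def m_def algebra_simps)
  finally have den: "1 - cnj (\<phi> b) * \<phi> z = m * (1 - cnj b * z) / (q' * p)" .
  show ?thesis
    unfolding num den using nz \<open>q' \<noteq> 0\<close>
    by (simp add: q_def[symmetric] q'_def[symmetric] divide_simps)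
qed

text \<open>Comparing coefficients with \<open>w = t a\<^sub>0\<close> leaves \<open>(t - 1) (1 - |a\<^sub>0|\<^sup>2 t) = r\<^sub>0\<^sup>2 t\<close>, which has a root with
  \<open>t |a\<^sub>0| < 1\<close>, and \<open>\<rho> = r\<^sub>0 / (1 - |a\<^sub>0|\<^sup>2 t)\<close>.\<close>
lemma circle_eq_pseudohyperbolic_circle:
  fixes a0 :: complex
  assumes "0 < r0" "cmod a0 + r0 < 1"
  obtains w \<rho> \<kappa> where "cmod w < 1" "0 < \<rho>" "\<rho> < 1" "0 < \<kappa>"
    "\<And>z. (cmod (z - w))\<^sup>2 - \<rho>\<^sup>2 * (cmod (1 - cnj w * z))\<^sup>2 = \<kappa> * ((cmod (z - a0))\<^sup>2 - r0\<^sup>2)"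
proof -
  define m where "m = cmod a0"
  define A where "A = m\<^sup>2"
  have m: "0 \<le> m" "m + r0 < 1"
    using assms by (auto simp: m_def)
  have "\<exists>t\<ge>1. t * m < 1 \<and> (t - 1) * (1 - A * t) = r0\<^sup>2 * t"
  proof (cases "m = 0")
    case True
    have "r0\<^sup>2 < 1"
      using assms m by (simp add: abs_square_less_1)
    with True show ?thesis
      by (intro exI[of _ "1 / (1 - r0\<^sup>2)"]) (auto simp: A_def field_simps)
  next
    case False
    \<comment> \<open>The intermediate value theorem on \<open>[1, 1 / m]\<close>:
      \<open>g 1 = r0\<^sup>2\<close>, while \<open>g (1 / m)\<close> is negative precisely because
      \<open>m + r0 < 1\<close>.\<close>
    define g where "g = (\<lambda>t. r0\<^sup>2 * t - (t - 1) * (1 - A * t))"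
    have "m > 0"
      using False m by simp
    have "r0\<^sup>2 < (1 - m)\<^sup>2"
      using assms m by (intro power_strict_mono) auto
    moreover have "g (1 / m) * m = r0\<^sup>2 - (1 - m)\<^sup>2"
      using \<open>m > 0\<close> by (simp add: g_def A_def power2_eq_square field_simps)
    ultimately have neg: "g (1 / m) < 0"
      using \<open>m > 0\<close> by (metis diff_less_0_iff_less mult_less_0_iff order.asym)
    have "continuous_on {1..1/m} g"
      unfolding g_def by (intro continuous_intros)
    moreover have "0 \<le> g 1" "1 \<le> 1 / m"
      using m \<open>m > 0\<close> assms by (auto simp: g_def)
    ultimately obtain t where t: "1 \<le> t" "t \<le> 1 / m" "g t = 0"
      using IVT2'[of g "1 / m" 0 1] neg by auto
    moreover have "t \<noteq> 1 / m"
      using neg t by auto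
    ultimately show ?thesis
      using \<open>m > 0\<close> by (intro exI[of _ t]) (auto simp: g_def field_simps)
  qed
  then obtain t where t: "t \<ge> 1" "t * m < 1" and root: "(t - 1) * (1 - A * t) = r0\<^sup>2 * t"
    by blast
  have "A * t = m * (t * m)"
    by (simp add: A_def power2_eq_square)
  also have "\<dots> \<le> m"
    using t m by (simp add: mult_left_le)
  finally have At: "r0 < 1 - A * t"
    using m by simp
  define \<rho> where "\<rho> = r0 / (1 - A * t)"
  define w where "w = of_real t * a0"
  \<comment> \<open>The coefficient of |z|^2 on the left-hand side of the identity to be
    shown.\<close>
  define \<kappa> where "\<kappa> = 1 - \<rho>\<^sup>2 * (t\<^sup>2 * A)"
  have \<rho>: "0 < \<rho>" "\<rho> < 1"
    using At assms by (auto simp: \<rho>_def)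
  have w: "cmod w = t * m"
    using t by (simp add: w_def m_def norm_mult)
  have tA: "t\<^sup>2 * A = (t * m)\<^sup>2" "(t * m)\<^sup>2 < 1"
    using t m abs_square_less_1[of "t * m"] by (simp_all add: A_def power_mult_distrib)
  have "\<rho>\<^sup>2 < 1"
    using \<rho> by (simp add: abs_square_less_1)
  then have "\<rho>\<^sup>2 * (t\<^sup>2 * A) < 1"
    using tA by (metis less_eq_real_def mult_le_one not_less power2_eq_square zero_le_power2
        mult_strict_mono' mult_1)
  then have "\<kappa> > 0"
    by (simp add: \<kappa>_def)
  define d where "d = 1 - A * t"
  have d: "d > 0" "\<rho> = r0 / d" "A * t = 1 - d"
    using At assms by (auto simp: d_def \<rho>_def)
  have r0: "r0\<^sup>2 * t = (t - 1) * d"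
    using root by (simp add: d_def)
  have \<rho>t: "\<rho>\<^sup>2 * d * t = t - 1"
  proof -
    have "\<rho>\<^sup>2 * d * t = r0\<^sup>2 * t / d"
      using d by (simp add: power_divide power2_eq_square)
    then show ?thesis
      using r0 d by simp
  qed
  \<comment> \<open>\<open>e1\<close> matches the coefficients of \<open>Re (z * cnj a0)\<close>,
    and \<open>e2\<close> below matches the constant terms.\<close>
  have e1: "\<kappa> = t * (1 - \<rho>\<^sup>2)"
  proof -
    have "\<kappa> = 1 - \<rho>\<^sup>2 * t * (A * t)"
      by (simp add: \<kappa>_def power2_eq_square mult_ac)
    also have "\<dots> = 1 - \<rho>\<^sup>2 * t + \<rho>\<^sup>2 * d * t"
      by (simp add: d algebra_simps)
    finally show ?thesis
      unfolding \<rho>t by (simp add: algebra_simps)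
  qed
  have e2: "\<kappa> * (A - r0\<^sup>2) = t\<^sup>2 * A - \<rho>\<^sup>2"
  proof -
    have "\<kappa> * (A - r0\<^sup>2) = (1 - \<rho>\<^sup>2) * (A * t) - (1 - \<rho>\<^sup>2) * (r0\<^sup>2 * t)"
      by (simp add: e1 algebra_simps)
    also have "\<dots> = (1 - \<rho>\<^sup>2) * (1 - t * d)"
      unfolding r0 d(3) by (simp add: algebra_simps)
    also have "\<dots> = t * (1 - d) - \<rho>\<^sup>2"
      using \<rho>t by (simp add: algebra_simps)
    also have "t * (1 - d) = t\<^sup>2 * A"
      unfolding d(3)[symmetric] by (simp add: power2_eq_square)
    finally show ?thesis .
  qed
  show thesis
  proof
    show "cmod w < 1" "0 < \<rho>" "\<rho> < 1" "0 < \<kappa>"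
      using w t \<rho> \<open>\<kappa> > 0\<close> by auto
    fix z
    define X where "X = (cmod z)\<^sup>2"
    define Y where "Y = Re z * Re a0 + Im z * Im a0"
    have A: "A = (Re a0)\<^sup>2 + (Im a0)\<^sup>2"
      by (simp add: A_def m_def cmod_power2)
    have 1: "(cmod (z - w))\<^sup>2 = X - 2 * t * Y + t\<^sup>2 * A"
      unfolding cmod_power2 w_def X_def Y_def A by (simp add: power2_eq_square algebra_simps)
    have 2: "(cmod (1 - cnj w * z))\<^sup>2 = 1 - 2 * t * Y + t\<^sup>2 * A * X"
      unfolding cmod_power2 w_def X_def Y_def A by (simp add: power2_eq_square algebra_simps)
    have 3: "(cmod (z - a0))\<^sup>2 = X - 2 * Y + A"
      unfolding cmod_power2 X_def Y_def A by (simp add: power2_eq_square algebra_simps)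
    have "(cmod (z - w))\<^sup>2 - \<rho>\<^sup>2 * (cmod (1 - cnj w * z))\<^sup>2
        = \<kappa> * X - 2 * (t * (1 - \<rho>\<^sup>2)) * Y + (t\<^sup>2 * A - \<rho>\<^sup>2)"
      unfolding 1 2 by (simp add: \<kappa>_def algebra_simps)
    also have "\<dots> = \<kappa> * ((cmod (z - a0))\<^sup>2 - r0\<^sup>2)"
      unfolding 3 e1[symmetric] e2[symmetric] by (simp add: algebra_simps)
    finally show "(cmod (z - w))\<^sup>2 - \<rho>\<^sup>2 * (cmod (1 - cnj w * z))\<^sup>2 = \<kappa> * ((cmod (z - a0))\<^sup>2 - r0\<^sup>2)" .
  qed
qed


text \<open>In the preceding identity both sides factor as differences of squares, with positive
  cofactors. So |\<phi>(z)| - \<rho> and |z - a0| - r0 have the same sign, where \<phi> is the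
  Moebius map of \<open>w\<close>; this covers both the disc and its boundary circle.\<close>

lemma Moebius_maps_disc_to_centred_disc:
  fixes a0 :: complex
  assumes "0 < r0" "cmod a0 + r0 < 1"
  obtains w \<rho> where "cmod w < 1" "0 < \<rho>" "\<rho> < 1"
    "\<And>z. cmod z < 1 \<Longrightarrow> cmod (Moebius_function 0 w z) < \<rho> \<longleftrightarrow> cmod (z - a0) < r0"
    "\<And>z. cmod z < 1 \<Longrightarrow> cmod (Moebius_function 0 w z) = \<rho> \<longleftrightarrow> cmod (z - a0) = r0"
proof -
  obtain w \<rho> \<kappa> where w: "cmod w < 1" and \<rho>: "0 < \<rho>" "\<rho> < 1" and \<kappa>: "0 < \<kappa>"
    and eq: "\<And>z. (cmod (z - w))\<^sup>2 - \<rho>\<^sup>2 * (cmod (1 - cnj w * z))\<^sup>2 = \<kappa> * ((cmod (z - a0))\<^sup>2 - r0\<^sup>2)"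
    using circle_eq_pseudohyperbolic_circle[OF assms] by blast
  have sgn_eq: "sgn (cmod (Moebius_function 0 w z) - \<rho>) = sgn (cmod (z - a0) - r0)"
    if "cmod z < 1" for z
  proof -
    define M where "M = cmod (Moebius_function 0 w z)"
    define D where "D = (cmod (1 - cnj w * z))\<^sup>2"
    have "D > 0"
      using one_minus_cnj_mult_nonzero[OF w that] by (simp add: D_def)
    have "(cmod (z - w))\<^sup>2 = M\<^sup>2 * D"
      using one_minus_cnj_mult_nonzero[OF w that]
      by (simp add: M_def D_def Moebius_function_simple norm_divide power_divide)
    then have "(M\<^sup>2 - \<rho>\<^sup>2) * D = \<kappa> * ((cmod (z - a0))\<^sup>2 - r0\<^sup>2)"
      using eq[of z] by (simp add: D_def algebra_simps)
    then have "(M - \<rho>) * ((M + \<rho>) * D) = (cmod (z - a0) - r0) * (\<kappa> * (cmod (z - a0) + r0))"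
      by (simp add: power2_eq_square algebra_simps)
    then have "sgn (M - \<rho>) * sgn ((M + \<rho>) * D)
        = sgn (cmod (z - a0) - r0) * sgn (\<kappa> * (cmod (z - a0) + r0))"
      by (metis sgn_mult)
    moreover have "(M + \<rho>) * D > 0" "\<kappa> * (cmod (z - a0) + r0) > 0"
      using \<open>D > 0\<close> \<rho> \<kappa> assms by (auto simp: M_def intro!: mult_pos_pos add_nonneg_pos)
    ultimately show ?thesis
      by (simp add: M_def)
  qed
  show thesis
  proof (rule that[OF w \<rho>])
    fix z :: complex
    assume "cmod z < 1"
    from sgn_eq[OF this]
    show "cmod (Moebius_function 0 w z) < \<rho> \<longleftrightarrow> cmod (z - a0) < r0"
      "cmod (Moebius_function 0 w z) = \<rho> \<longleftrightarrow> cmod (z - a0) = r0"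
      by (auto simp: sgn_if split: if_splits)
  qed
qed

text \<open>Factor by factor this is the invariance above with \<open>b\<close> the preimage of
  \<open>a\<close>; the constants do not depend on \<open>z\<close> and multiply to
  \<open>k\<close>.\<close>

lemma blaschke_product_Moebius:
  fixes A :: "complex multiset"
  assumes w: "cmod w < 1" and A: "\<forall>a\<in>#A. cmod a < 1"
  obtains k where "\<And>z. cmod z < 1 \<Longrightarrow>
    (\<Prod>a\<in>#A. (Moebius_function 0 w z - a) / (1 - cnj a * Moebius_function 0 w z))
      = k * (\<Prod>b\<in>#image_mset (Moebius_function 0 (- w)) A. (z - b) / (1 - cnj b * z))"
proof
  let ?\<psi> = "Moebius_function 0 (- w)"
  fix z :: complex
  assume "cmod z < 1"
  have "(Moebius_function 0 w z - a) / (1 - cnj a * Moebius_function 0 w z)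
      = (1 - w * cnj (?\<psi> a)) / (1 - cnj w * ?\<psi> a) * ((z - ?\<psi> a) / (1 - cnj (?\<psi> a) * z))"
    if "a \<in># A" for a
  proof -
    have "cmod (?\<psi> a) < 1" "Moebius_function 0 w (?\<psi> a) = a"
      using A w that by (auto intro: Moebius_function_norm_lt_1 Moebius_function_compose)
    then show ?thesis
      using blaschke_quotient_Moebius[OF w _ \<open>cmod z < 1\<close>, of "?\<psi> a"] by simp
  qed
  then have "(\<Prod>a\<in>#A. (Moebius_function 0 w z - a) / (1 - cnj a * Moebius_function 0 w z))
      = (\<Prod>a\<in>#A. (1 - w * cnj (?\<psi> a)) / (1 - cnj w * ?\<psi> a) * ((z - ?\<psi> a) / (1 - cnj (?\<psi> a) * z)))"
    by (simp cong: image_mset_cong)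
  also have "\<dots> = (\<Prod>a\<in>#A. (1 - w * cnj (?\<psi> a)) / (1 - cnj w * ?\<psi> a))
      * (\<Prod>b\<in>#image_mset ?\<psi> A. (z - b) / (1 - cnj b * z))"
    unfolding prod_mset.distrib by (simp add: multiset.map_comp o_def)
  finally show "(\<Prod>a\<in>#A. (Moebius_function 0 w z - a) / (1 - cnj a * Moebius_function 0 w z)) = \<dots>" .
qed

section \<open>Transport from the centred disc to the given disc\<close>

theorem theorem3p2:
  fixes a0 :: complex and r0 :: real and f :: "complex \<Rightarrow> complex" and U :: "complex set"
    and \<delta> :: real
  assumes "r0 > 0" and "cball a0 r0 \<subseteq> ball 0 1"
    and "open U" and "cball a0 r0 \<subseteq> U"
    and "f analytic_on U" and "\<forall>z\<in>U. f z \<noteq> 0"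
    and "0 < \<delta>" and "\<delta> < r0"
  shows "\<forall>\<epsilon>>0. \<exists>(c::complex) B. is_blaschke_product B \<and>
           (\<forall>z\<in>ball 0 1. B z = 0 \<longrightarrow> z \<in> sphere a0 r0) \<and>
           (\<forall>z\<in>ball a0 (r0 - \<delta>). cmod (f z - c * B z) < \<epsilon>)"
proof (intro allI impI)
  fix \<epsilon> :: real
  assume "\<epsilon> > 0"
  have "cmod a0 + r0 < 1"
    using assms(1,2) by (simp add: cball_subset_ball_iff)
  then obtain w \<rho> where w: "cmod w < 1" and \<rho>: "0 < \<rho>" "\<rho> < 1"
    and disc: "\<And>z. cmod z < 1 \<Longrightarrow> cmod (Moebius_function 0 w z) < \<rho> \<longleftrightarrow> cmod (z - a0) < r0"
    and circle: "\<And>z. cmod z < 1 \<Longrightarrow> cmod (Moebius_function 0 w z) = \<rho> \<longleftrightarrow> cmod (z - a0) = r0"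
    using Moebius_maps_disc_to_centred_disc[OF assms(1)] by blast
  define \<phi> where "\<phi> = Moebius_function 0 w"
  define \<psi> where "\<psi> = Moebius_function 0 (- w)"
  have norm_\<psi>: "cmod (\<psi> u) < 1" and \<phi>\<psi>: "\<phi> (\<psi> u) = u" and \<psi>\<phi>: "\<psi> (\<phi> u) = u"
    if "cmod u < 1" for u
    using that w by (auto simp: \<phi>_def \<psi>_def intro: Moebius_function_norm_lt_1 Moebius_function_compose)
  have \<psi>_hol: "\<psi> holomorphic_on ball 0 1" and \<phi>_hol: "\<phi> holomorphic_on ball 0 1"
    using w by (auto simp: \<phi>_def \<psi>_def intro!: Moebius_function_holomorphic)

  define V where "V = ball 0 1 \<inter> \<psi> -` U"
  have "open V"
    unfolding V_def using \<psi>_hol assms(3)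
    by (intro continuous_open_preimage holomorphic_on_imp_continuous_on) auto
  moreover have "cball 0 \<rho> \<subseteq> V"
  proof
    fix u :: complex
    assume u: "u \<in> cball 0 \<rho>"
    then have "cmod u < 1"
      using \<rho> by simp
    then have "cmod (\<psi> u - a0) \<le> r0"
      using disc[OF norm_\<psi>] circle[OF norm_\<psi>] u \<phi>\<psi>[of u] by (fastforce simp: \<phi>_def le_less)
    then show "u \<in> V"
      using \<open>cmod u < 1\<close> assms(4) by (auto simp: V_def dist_norm norm_minus_commute)
  qed
  ultimately obtain e where e: "e > 0" "(\<Union>x\<in>cball 0 \<rho>. ball x e) \<subseteq> V"
    using compact_subset_open_imp_ball_epsilon_subset[OF compact_cball] by metis
  have ball_V: "ball 0 (\<rho> + e) \<subseteq> V"
  proof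
    fix u :: complex
    assume u: "u \<in> ball 0 (\<rho> + e)"
    show "u \<in> V"
    proof (cases "cmod u \<le> \<rho>")
      case True
      then show ?thesis
        using \<open>cball 0 \<rho> \<subseteq> V\<close> by auto
    next
      case False
      \<comment> \<open>The radial projection of \<open>u\<close> onto the circle, at distance
        \<open>|u| - \<rho> < e\<close> from \<open>u\<close>.\<close>
      define x where "x = of_real (\<rho> / cmod u) * u"
      have "cmod x = \<rho>"
        using False \<rho> by (auto simp: x_def norm_mult norm_divide)
      have "u - x = of_real (1 - \<rho> / cmod u) * u"
        by (simp add: x_def algebra_simps)
      then have "cmod (u - x) = \<bar>1 - \<rho> / cmod u\<bar> * cmod u"
        by (simp only: norm_mult norm_of_real)
      also have "\<dots> = cmod u - \<rho>"
        using False \<rho> by (cases "u = 0") (auto simp: abs_if field_simps)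
      finally have "u \<in> ball x e"
        using u by (simp add: dist_norm norm_minus_commute)
      moreover have "x \<in> cball 0 \<rho>"
        using \<open>cmod x = \<rho>\<close> by simp
      ultimately show ?thesis
        using e(2) by blast
    qed
  qed
  define F where "F = f \<circ> \<psi>"
  have "F holomorphic_on V"
    unfolding F_def
    by (rule holomorphic_on_compose_gen[of _ _ _ U])
      (use \<psi>_hol assms(5) in \<open>auto simp: V_def intro: holomorphic_on_subset analytic_imp_holomorphic\<close>)
  then have F_hol: "F holomorphic_on ball 0 (\<rho> + e)"
    using ball_V by (rule holomorphic_on_subset)
  have F_nz: "F u \<noteq> 0" if "cmod u < \<rho> + e" for u
    using ball_V that assms(6) by (auto simp: F_def V_def)
  have "F 0 \<noteq> 0"
    using F_nz[of 0] \<rho> e by simp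

  let ?K = "cball a0 (r0 - \<delta>)"
  have K: "cmod z < 1" "cmod (z - a0) < r0" if "z \<in> ?K" for z
    using that assms(2,7,8) by (auto simp: dist_norm norm_minus_commute subset_iff)
  have "continuous_on ?K (\<lambda>z. cmod (\<phi> z))"
    using K by (intro continuous_on_norm holomorphic_on_imp_continuous_on holomorphic_on_subset[OF \<phi>_hol])
      (auto simp del: mem_cball)
  moreover have "?K \<noteq> {}"
    using assms(8) by simp
  ultimately obtain x where x: "x \<in> ?K" "\<And>z. z \<in> ?K \<Longrightarrow> cmod (\<phi> z) \<le> cmod (\<phi> x)"
    using continuous_attains_sup[of ?K "\<lambda>z. cmod (\<phi> z)"] compact_cball by blast
  \<comment> \<open>Halfway between the maximum of |\<phi>| on \<open>?K\<close> and
    \<open>\<rho>\<close>: positive, below \<open>\<rho>\<close>, and large enough for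
    \<open>\<phi>\<close> to map \<open>?K\<close> into \<open>cball 0 s\<close>.\<close>
  define s where "s = (cmod (\<phi> x) + \<rho>) / 2"
  have "cmod (\<phi> x) < \<rho>"
    using disc[OF K(1)[OF x(1)]] K(2)[OF x(1)] by (simp add: \<phi>_def)
  then have s: "0 < s" "s < \<rho>" "cmod (\<phi> x) \<le> s"
    using \<rho> add_nonneg_pos[OF norm_ge_zero[of "\<phi> x"] \<rho>(1)] by (simp_all add: s_def)
  have "approximable_on (cball 0 s) (circle_blaschke_quotients \<rho>) (\<lambda>z. F z / F 0)"
    using approximable_holomorphic[OF \<rho> s(1,2) F_hol _ F_nz] e by simp
  \<comment> \<open>Only \<open>F / F 0\<close> is approximated, so the tolerance is scaled to
    compensate for multiplying back by \<open>F 0\<close>.\<close>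
  moreover have "\<epsilon> / cmod (F 0) > 0"
    using \<open>\<epsilon> > 0\<close> \<open>F 0 \<noteq> 0\<close> by simp
  ultimately obtain g where g: "\<And>u. u \<in> cball 0 s \<Longrightarrow> cmod (F u / F 0 - g u) < \<epsilon> / cmod (F 0)"
    and "g \<in> circle_blaschke_quotients \<rho>"
    unfolding approximable_on_def by blast
  then obtain c A where A: "\<forall>a\<in>#A. cmod a = \<rho>"
    and g_eq: "g = (\<lambda>u. c * (\<Prod>a\<in>#A. (u - a) / (1 - cnj a * u)))"
    by (auto simp: circle_blaschke_quotients_def)
  define M where "M = image_mset \<psi> A"
  define B where "B z = (\<Prod>b\<in>#M. (z - b) / (1 - cnj b * z))" for z
  obtain k where k: "\<And>z. cmod z < 1 \<Longrightarrow> (\<Prod>a\<in>#A. (\<phi> z - a) / (1 - cnj a * \<phi> z)) = k * B z"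
    unfolding \<phi>_def \<psi>_def M_def B_def
    by (rule blaschke_product_Moebius[OF w, of A]) (use A \<rho> in auto)
  have M: "cmod b < 1" "cmod (b - a0) = r0" if b: "b \<in># M" for b
  proof -
    obtain a where a: "a \<in># A" "b = \<psi> a"
      using b by (auto simp: M_def)
    then have "cmod a = \<rho>" "cmod a < 1"
      using A \<rho> by auto
    then show "cmod b < 1" "cmod (b - a0) = r0"
      using norm_\<psi>[of a] circle[of b] \<phi>\<psi>[of a] a by (auto simp: \<phi>_def)
  qed
  show "\<exists>c B. is_blaschke_product B \<and> (\<forall>z\<in>ball 0 1. B z = 0 \<longrightarrow> z \<in> sphere a0 r0) \<and>
      (\<forall>z\<in>ball a0 (r0 - \<delta>). cmod (f z - c * B z) < \<epsilon>)"
  proof (intro exI conjI ballI impI)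
    show "is_blaschke_product B"
      unfolding B_def using M by (intro is_blaschke_product_finite) auto
    fix z :: complex
    assume z: "z \<in> ball 0 1" "B z = 0"
    then obtain b where b: "b \<in># M" "(z - b) / (1 - cnj b * z) = 0"
      by (auto simp: B_def prod_mset_zero_iff)
    \<comment> \<open>A factor is also 0 by convention when its denominator is, so the denominator
      must first be shown nonzero inside the unit disc.\<close>
    then have "z = b"
      using one_minus_cnj_mult_nonzero[of b z] M(1) z by auto
    then show "z \<in> sphere a0 r0"
      using M(2)[OF b(1)] by (simp add: dist_norm norm_minus_commute)
  next
    fix z
    assume z: "z \<in> ball a0 (r0 - \<delta>)"
    then have "z \<in> ?K"
      by auto
    have z1: "cmod z < 1" and "\<phi> z \<in> cball 0 s"
      using K(1)[OF \<open>z \<in> ?K\<close>] x(2)[OF \<open>z \<in> ?K\<close>] s by auto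
    have "F (\<phi> z) = f z"
      by (simp add: F_def \<psi>\<phi>[OF z1])
    \<comment> \<open>The required constant is \<open>F 0 * c * k\<close>: the normalisation of
      \<open>F\<close>, the constant of \<open>g\<close>, and the one from the Moebius change of
      variable.\<close>
    then have "f z - F 0 * c * k * B z = F 0 * (F (\<phi> z) / F 0 - g (\<phi> z))"
      using \<open>F 0 \<noteq> 0\<close> by (simp add: g_eq k[OF z1] algebra_simps)
    then have "cmod (f z - F 0 * c * k * B z) = cmod (F 0) * cmod (F (\<phi> z) / F 0 - g (\<phi> z))"
      by (simp only: norm_mult)
    also have "\<dots> < \<epsilon>"
      using g[OF \<open>\<phi> z \<in> cball 0 s\<close>] \<open>F 0 \<noteq> 0\<close> by (simp add: field_simps)
    finally show "cmod (f z - F 0 * c * k * B z) < \<epsilon>" .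
  qed
qed

end
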